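(* Let $\mathcal{N}=\{0,1,\ldots,N\}$ for some $N\in\mathbb{Z}_{\ge0}$, or $\mathcal{N}=\mathbb{Z}_{\ge0}$. Let $\{y_x\}_{x\in\mathcal{N}}\subset\mathbb{R}$, let $w_x>0$ and $\omega_n>0$ ($x,n\in\mathcal{N}$), and let $\{p_n\}_{n\in\mathcal{N}}$ be real polynomials with $p_n$ of degree $n$ which form a complete orthogonal system in the sense that $$\sum_{x\in\mathcal{N}}p_n(y_x)\,p_m(y_x)\,w_x=\omega_n^{-1}\,\delta_{n,m}\quad(n,m\in\mathcal{N}),\qquad \sum_{n\in\mathcal{N}}p_n(y_x)\,p_n(y_{x'})\,\omega_n=w_x^{-1}\,\delta_{x,x'}\quad(x,x'\in\mathcal{N}).$$ Assume that there exist dual orthogonal polynomials, i.e. polynomials $r_x$ of degree $x$ ($x\in\mathcal{N}$) and a subset $\{z_n\}_{n\in\mathcal{N}}$ of $\mathbb{R}$ such that $$p_n(y_x)=r_x(z_n)\quad(n,x\in\mathcal{N}).$$ Let $P,B,C$ be the matrices with rows and columns indexed by $\mathcal{N}$ and entries $$P_{n,x}:=p_n(y_x),\qquad B_{n,k}:=\prod_{i=0}^{k-1}(z_i-z_n),\qquad C_{k,x}:=\prod_{j=0}^{k-1}(y_j-y_x).$$ Then $B$ is lower triangular, $C$ is upper triangular, and there is a diagonal matrix $D$ with nonzero diagonal entries $\delta_k$ ($k\in\mathcal{N}$) such that $P=BDC$, i.e. $$p_n(y_x)=\sum_{k=0}^{\min(n,x)}\delta_k\,\prod_{i=0}^{k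-1}(z_i-z_n)\,\prod_{j=0}^{k-1}(y_j-y_x)\qquad(n,x\in\mathcal{N}).$$
   Context: Here $\delta_{n,m}$ with two indices denotes the Kronecker delta, while $\delta_k$ with one index denotes the diagonal entries of $D$. Empty products are equal to $1$. A matrix $M$ is lower (upper) triangular if $M_{i,j}=0$ whenever $i<j$ (respectively $i>j$). *)

theory Defs
  imports "HOL-Analysis.Analysis" "HOL-Computational_Algebra.Polynomial"
begin

text \<open>
  A matrix whose rows and columns are indexed by a set I of naturals is a function
  \<^typ>\<open>nat \<Rightarrow> nat \<Rightarrow> real\<close>; only its values at indices in I are relevant.
\<close>

definition lower_triangular_on :: "nat set \<Rightarrow> (nat \<Rightarrow> nat \<Rightarrow> real) \<Rightarrow> bool" where
  "lower_triangular_on I M \<longleftrightarrow> (\<forall>i\<in>I. \<forall>j\<in>I. i < j \<longrightarrow> M i j = 0)"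

definition upper_triangular_on :: "nat set \<Rightarrow> (nat \<Rightarrow> nat \<Rightarrow> real) \<Rightarrow> bool" where
  "upper_triangular_on I M \<longleftrightarrow> (\<forall>i\<in>I. \<forall>j\<in>I. i > j \<longrightarrow> M i j = 0)"

text \<open>
  The index set may be infinite, so the entries of a product are infinite sums. In the product
  BDC below each of these sums has only finitely many nonzero terms, so the default value 0 of
  a divergent sum plays no role.
\<close>

definition matrix_prod_on ::
    "nat set \<Rightarrow> (nat \<Rightarrow> nat \<Rightarrow> real) \<Rightarrow> (nat \<Rightarrow> nat \<Rightarrow> real) \<Rightarrow> nat \<Rightarrow> nat \<Rightarrow> real" where
  "matrix_prod_on I M M' i j = (\<Sum>\<^sub>\<infinity>k\<in>I. M i k * M' k j)"

definition diagonal_matrix :: "(nat \<Rightarrow> real) \<Rightarrow> nat \<Rightarrow> nat \<Rightarrow> real" where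
  "diagonal_matrix d i j = (if i = j then d i else 0)"

definition P_matrix :: "(nat \<Rightarrow> real poly) \<Rightarrow> (nat \<Rightarrow> real) \<Rightarrow> nat \<Rightarrow> nat \<Rightarrow> real" where
  "P_matrix p y n x = poly (p n) (y x)"

definition B_matrix :: "(nat \<Rightarrow> real) \<Rightarrow> nat \<Rightarrow> nat \<Rightarrow> real" where
  "B_matrix z n k = (\<Prod>i<k. z i - z n)"

definition C_matrix :: "(nat \<Rightarrow> real) \<Rightarrow> nat \<Rightarrow> nat \<Rightarrow> real" where
  "C_matrix y k x = (\<Prod>j<k. y j - y x)"

end

(*
  Expanding each p_n in the Newton basis at the nodes y_j gives P = A C with A lower triangular,
  and expanding each r_x in the Newton basis at the nodes z_i gives P = B R with R upper
  triangular. Completeness and orthogonality force the y_x and the z_n to be pairwise distinct,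
  so C and B are invertible, and the uniqueness of the LU factorization yields A = B D and R = D C
  for one diagonal matrix D. Its entries are nonzero because the diagonal entries of R are the
  leading coefficients of the r_x up to sign.
*)
theory Submission imports Defs
begin

lemma degree_newton_basis: "degree (\<Prod>j<n. [:u j, - 1:] :: 'a::idom poly) = n"
  by (subst degree_prod_eq_sum_degree) auto

lemma coeff_newton_basis: "coeff (\<Prod>j<n. [:u j, - 1:] :: 'a::idom poly) n = (- 1) ^ n"
  using lead_coeff_prod[of "\<lambda>j. [:u j, - 1:]" "{..<n}"] by (simp add: degree_newton_basis)

text \<open>Only the last basis polynomial has degree \<open>n\<close>, with leading coefficient
  \<open>(- 1) ^ n\<close>, so subtracting a suitable multiple of it lowers the degree and induction
  applies. The value of \<open>a n\<close> is recorded because it later decides that the diagonal is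
  nonzero.\<close>

lemma newton_expansion_poly:
  fixes q :: "'a::idom poly"
  assumes "degree q \<le> n"
  shows "\<exists>a. q = (\<Sum>k\<le>n. smult (a k) (\<Prod>j<k. [:u j, - 1:])) \<and> a n = (- 1) ^ n * coeff q n"
  using assms
proof (induction n arbitrary: q)
  case 0
  then obtain c where "q = [:c:]" by (metis degree_eq_zeroE le_zero_eq)
  then show ?case by (intro exI[of _ "\<lambda>_. c"]) simp
next
  case (Suc n)
  let ?e = "\<Prod>j<Suc n. [:u j, - 1:]"
  \<comment> \<open>The sign is its own inverse, so this \<open>c\<close> cancels the top
    coefficient of \<open>q\<close>.\<close>
  define c where "c = (- 1) ^ Suc n * coeff q (Suc n)"
  have "c * (- 1) ^ Suc n = coeff q (Suc n)"
    by (simp add: c_def mult.assoc mult.commute flip: power_mult_distrib)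
  then have "coeff (q - smult c ?e) (Suc n) = 0"
    using coeff_newton_basis[of u "Suc n"] by (simp del: prod.lessThan_Suc power_Suc)
  moreover have "degree (q - smult c ?e) \<le> Suc n"
    using Suc.prems degree_newton_basis[of u "Suc n"]
    by (metis degree_diff_le degree_smult_le)
  ultimately have "degree (q - smult c ?e) \<le> n"
    by (metis coeff_0 degree_0 le_SucE le0 leading_coeff_0_iff)
  from Suc.IH[OF this] obtain a
    where a: "q - smult c ?e = (\<Sum>k\<le>n. smult (a k) (\<Prod>j<k. [:u j, - 1:]))"
    by blast
  have "(\<Sum>k\<le>Suc n. smult ((a(Suc n := c)) k) (\<Prod>j<k. [:u j, - 1:]))
      = (\<Sum>k\<le>n. smult (a k) (\<Prod>j<k. [:u j, - 1:])) + smult c ?e"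
    by (simp del: prod.lessThan_Suc)
  also have "\<dots> = q" by (simp only: a[symmetric] diff_add_cancel)
  finally show ?case
    by (intro exI[of _ "a(Suc n := c)"]) (simp add: c_def)
qed

text \<open>The form used for evaluation. The zero polynomial also has degree 0, hence the
  equivalence for \<open>a n\<close> instead of plain nonvanishing.\<close>

lemma newton_expansion:
  fixes q :: "'a::idom poly"
  assumes "degree q = n"
  obtains a where "\<And>t. poly q t = (\<Sum>k\<le>n. a k * (\<Prod>j<k. u j - t))" "a n = 0 \<longleftrightarrow> q = 0"
proof -
  obtain a where a: "q = (\<Sum>k\<le>n. smult (a k) (\<Prod>j<k. [:u j, - 1:]))"
    and an: "a n = (- 1) ^ n * coeff q n"
    using newton_expansion_poly[of q n u] assms by auto
  show thesis
  proof
    show "poly q t = (\<Sum>k\<le>n. a k * (\<Prod>j<k. u j - t))" for t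
      by (subst a) (simp add: poly_sum poly_prod)
    show "a n = 0 \<longleftrightarrow> q = 0"
      using assms by (auto simp: an)
  qed
qed

text \<open>Column \<open>k\<close> of the left factors and row \<open>k\<close> of the right
  factors are compared by strong induction on \<open>k\<close>. Cutting the sums at
  \<open>min n x\<close> encodes triangularity and keeps them finite for infinite \<open>I\<close>,
  so no inverse matrices are formed.\<close>

lemma LU_factorization_unique:
  fixes A B C R :: "nat \<Rightarrow> nat \<Rightarrow> 'a::field"
  assumes down_closed: "\<And>j k. k \<in> I \<Longrightarrow> j \<le> k \<Longrightarrow> j \<in> I"
    and eq: "\<And>n x. n \<in> I \<Longrightarrow> x \<in> I \<Longrightarrow>
      (\<Sum>k\<le>min n x. A n k * C k x) = (\<Sum>k\<le>min n x. B n k * R k x)"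
    and B: "\<And>k. k \<in> I \<Longrightarrow> B k k \<noteq> 0"
    and C: "\<And>k. k \<in> I \<Longrightarrow> C k k \<noteq> 0"
    and k: "k \<in> I"
  shows "(\<forall>n\<in>I. k \<le> n \<longrightarrow> A n k = R k k / C k k * B n k) \<and>
         (\<forall>x\<in>I. k \<le> x \<longrightarrow> R k x = R k k / C k k * C k x)"
  using k
proof (induction k rule: less_induct)
  case (less k)
  \<comment> \<open>For \<open>j < k\<close> the same factor relates \<open>A\<close> to
    \<open>B\<close> and \<open>R\<close> to \<open>C\<close>, so these terms agree on both sides;
    only the term with index \<open>k\<close> survives.\<close>
  have cancel: "A n k * C k x = B n k * R k x"
    if "n \<in> I" "x \<in> I" "min n x = k" for n x
  proof -
    have "A n j * C j x = B n j * R j x" if "j < k" for j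
    proof -
      have "j \<in> I" using down_closed less.prems \<open>j < k\<close> by (meson less_imp_le)
      have "j \<le> n" "j \<le> x" using \<open>j < k\<close> \<open>min n x = k\<close> by auto
      with less.IH[OF \<open>j < k\<close> \<open>j \<in> I\<close>] \<open>n \<in> I\<close> \<open>x \<in> I\<close>
      obtain d where "A n j = d * B n j" "R j x = d * C j x" by blast
      then show ?thesis by simp
    qed
    then have "(\<Sum>j<k. A n j * C j x) = (\<Sum>j<k. B n j * R j x)" by simp
    with eq[OF that(1,2)] that(3) show ?thesis
      by (simp flip: lessThan_Suc_atMost)
  qed
  \<comment> \<open>Column \<open>x = k\<close> determines \<open>A n k\<close>; after that, row
    \<open>n = k\<close> determines \<open>R k x\<close>.\<close>
  have A: "A n k = R k k / C k k * B n k" if "n \<in> I" "k \<le> n" for n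
    using cancel[of n k] that less.prems C[OF less.prems] by (simp add: field_simps)
  have "R k x = R k k / C k k * C k x" if "x \<in> I" "k \<le> x" for x
  proof -
    have "B k k * R k x = B k k * (R k k / C k k * C k x)"
      using cancel[of k x] that less.prems A[of k] by (simp add: ac_simps)
    with B[OF less.prems] show ?thesis using mult_left_cancel by blast
  qed
  with A show ?case by blast
qed

theorem mainTheorem4:
  fixes I :: "nat set"
    and y w \<omega> z :: "nat \<Rightarrow> real"
    and p r :: "nat \<Rightarrow> real poly"
  assumes index_set: "(\<exists>N. I = {0..N}) \<or> I = UNIV"
    and w_pos: "\<And>x. x \<in> I \<Longrightarrow> w x > 0"
    and \<omega>_pos: "\<And>n. n \<in> I \<Longrightarrow> \<omega> n > 0"
    and degree_p: "\<And>n. n \<in> I \<Longrightarrow> degree (p n) = n"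
    and orthogonal: "\<And>n m. n \<in> I \<Longrightarrow> m \<in> I \<Longrightarrow>
      ((\<lambda>x. poly (p n) (y x) * poly (p m) (y x) * w x)
        has_sum (inverse (\<omega> n) * of_bool (n = m))) I"
    and complete: "\<And>x x'. x \<in> I \<Longrightarrow> x' \<in> I \<Longrightarrow>
      ((\<lambda>n. poly (p n) (y x) * poly (p n) (y x') * \<omega> n)
        has_sum (inverse (w x) * of_bool (x = x'))) I"
    and degree_r: "\<And>x. x \<in> I \<Longrightarrow> degree (r x) = x"
    and dual: "\<And>n x. n \<in> I \<Longrightarrow> x \<in> I \<Longrightarrow> poly (p n) (y x) = poly (r x) (z n)"
  shows "lower_triangular_on I (B_matrix z) \<and>
    upper_triangular_on I (C_matrix y) \<and>
    (\<exists>\<delta> :: nat \<Rightarrow> real. (\<forall>k\<in>I. \<delta> k \<noteq> 0) \<and>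
      (\<forall>n\<in>I. \<forall>x\<in>I.
        P_matrix p y n x =
          matrix_prod_on I (matrix_prod_on I (B_matrix z) (diagonal_matrix \<delta>)) (C_matrix y) n x) \<and>
      (\<forall>n\<in>I. \<forall>x\<in>I.
        poly (p n) (y x) =
          (\<Sum>k = 0..min n x. \<delta> k * (\<Prod>i<k. z i - z n) * (\<Prod>j<k. y j - y x))))"
proof -
  have down_closed: "j \<in> I" if "k \<in> I" "j \<le> k" for j k
    using index_set that by auto
  \<comment> \<open>If the nodes coincided, completeness would give one and the same series the sums
    \<open>inverse (w x)\<close> and 0.\<close>
  have y_inj: "y x \<noteq> y x'" if "x \<in> I" "x' \<in> I" "x \<noteq> x'" for x x'
  proof
    assume "y x = y x'"
    then have "inverse (w x) * of_bool (x = x) = inverse (w x) * of_bool (x = x')"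
      using complete[of x x] complete[of x x'] that has_sum_unique by fastforce
    with w_pos[of x] that show False by simp
  qed
  \<comment> \<open>By duality, equal \<open>z\<close> values make rows \<open>n\<close> and
    \<open>m\<close> of P equal, so orthogonality would force the squared norm
    \<open>inverse (\<omega> n)\<close> to be 0.\<close>
  have z_inj: "z n \<noteq> z m" if "n \<in> I" "m \<in> I" "n \<noteq> m" for n m
  proof
    assume "z n = z m"
    then have "poly (p m) (y x) = poly (p n) (y x)" if "x \<in> I" for x
      using that \<open>n \<in> I\<close> \<open>m \<in> I\<close> by (simp add: dual)
    then have "((\<lambda>x. poly (p n) (y x) * poly (p n) (y x) * w x)
        has_sum (inverse (\<omega> n) * of_bool (n = m))) I"
      using orthogonal[of n m] that by (simp cong: has_sum_cong)
    then have "inverse (\<omega> n) * of_bool (n = m) = inverse (\<omega> n) * of_bool (n = n)"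
      using orthogonal[of n n] that has_sum_unique by blast
    with \<omega>_pos[of n] that show False by simp
  qed
  have B_zero: "B_matrix z n k = 0" if "n < k" for n k
    using that by (auto simp: B_matrix_def)
  have C_zero: "C_matrix y k x = 0" if "x < k" for k x
    using that by (auto simp: C_matrix_def)
  have B_diag: "B_matrix z k k \<noteq> 0" if "k \<in> I" for k
    using z_inj down_closed[OF that] that by (force simp: B_matrix_def)
  have C_diag: "C_matrix y k k \<noteq> 0" if "k \<in> I" for k
    using y_inj down_closed[OF that] that by (force simp: C_matrix_def)
  \<comment> \<open>Positive degree excludes the zero polynomial. For \<open>x = 0\<close>,
    \<open>p 0\<close> is a constant of nonzero norm, and \<open>r 0\<close> takes its value at
    \<open>z 0\<close>.\<close>
  have r_nonzero: "r x \<noteq> 0" if "x \<in> I" for x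
  proof (cases x)
    case 0
    have "p 0 \<noteq> 0"
    proof
      assume "p 0 = 0"
      then have "((\<lambda>_. 0) has_sum inverse (\<omega> 0)) I"
        using orthogonal[of 0 0] 0 that by simp
      then have "inverse (\<omega> 0) = 0"
        by (rule has_sum_unique) (simp add: has_sum_0)
      with \<omega>_pos[of 0] 0 that show False by simp
    qed
    then have "poly (p 0) (y 0) \<noteq> 0"
      using degree_p[of 0] 0 that by (auto elim!: degree_eq_zeroE)
    with dual[of 0 0] 0 that show ?thesis by auto
  next
    case (Suc _)
    with degree_r[OF that] show ?thesis by auto
  qed
  have "\<exists>a. \<forall>t. poly (p n) t = (\<Sum>k\<le>n. a k * (\<Prod>j<k. y j - t))" if "n \<in> I" for n
    by (rule newton_expansion[OF degree_p[OF that], of y]) blast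
  then obtain A where A: "\<And>n t. n \<in> I \<Longrightarrow> poly (p n) t = (\<Sum>k\<le>n. A n k * (\<Prod>j<k. y j - t))"
    by metis
  \<comment> \<open>The coefficients come out as \<open>R x k\<close>, polynomial index first; the
    upper triangular factor is the transpose \<open>\<lambda>k x. R x k\<close>.\<close>
  have "\<exists>a. (\<forall>t. poly (r x) t = (\<Sum>k\<le>x. a k * (\<Prod>i<k. z i - t))) \<and> a x \<noteq> 0"
    if "x \<in> I" for x
    by (rule newton_expansion[OF degree_r[OF that], of z]) (use r_nonzero[OF that] in blast)
  then obtain R where R: "\<And>x t. x \<in> I \<Longrightarrow> poly (r x) t = (\<Sum>k\<le>x. R x k * (\<Prod>i<k. z i - t))"
    and R_diag: "\<And>x. x \<in> I \<Longrightarrow> R x x \<noteq> 0"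
    by metis
  \<comment> \<open>For \<open>k > x\<close> the product contains the factor
    \<open>y x - y x\<close>, which cuts the sum at \<open>min n x\<close>.\<close>
  have PAC: "poly (p n) (y x) = (\<Sum>k\<le>min n x. A n k * C_matrix y k x)" if "n \<in> I" for n x
    unfolding A[OF that] by (rule sum.mono_neutral_cong_right) (auto simp: C_matrix_def)
  have PBR: "poly (p n) (y x) = (\<Sum>k\<le>min n x. B_matrix z n k * R x k)"
    if "n \<in> I" "x \<in> I" for n x
    unfolding dual[OF that] R[OF that(2)]
    by (rule sum.mono_neutral_cong_right) (auto simp: B_matrix_def)
  \<comment> \<open>This is the proportionality factor from the uniqueness of the LU
    factorization.\<close>
  define \<delta> where "\<delta> k = R k k / C_matrix y k k" for k
  have \<delta>_nonzero: "\<delta> k \<noteq> 0" if "k \<in> I" for k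
    using that R_diag C_diag by (simp add: \<delta>_def)
  have A_eq: "A n k = \<delta> k * B_matrix z n k" if "n \<in> I" "k \<le> n" for n k
  proof -
    have "k \<in> I" using down_closed that by blast
    have factorizations: "(\<Sum>k\<le>min n x. A n k * C_matrix y k x) = (\<Sum>k\<le>min n x. B_matrix z n k * R x k)"
      if "n \<in> I" "x \<in> I" for n x
      using PAC[OF that(1), of x] PBR[OF that] by (rule trans[OF sym])
    note LU = LU_factorization_unique[where I = I and A = A and B = "B_matrix z"
        and C = "C_matrix y" and R = "\<lambda>k x. R x k" and k = k]
    have "(\<forall>n\<in>I. k \<le> n \<longrightarrow> A n k = \<delta> k * B_matrix z n k) \<and>
        (\<forall>x\<in>I. k \<le> x \<longrightarrow> R x k = \<delta> k * C_matrix y k x)"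
      unfolding \<delta>_def by (rule LU) (fact down_closed factorizations B_diag C_diag \<open>k \<in> I\<close>)+
    with that show ?thesis by blast
  qed
  have P: "poly (p n) (y x) = (\<Sum>k = 0..min n x. \<delta> k * B_matrix z n k * C_matrix y k x)"
    if "n \<in> I" for n x
    unfolding PAC[OF that] atLeast0AtMost by (intro sum.cong) (auto simp: A_eq that)
  have BD: "matrix_prod_on I (B_matrix z) (diagonal_matrix \<delta>) n k = B_matrix z n k * \<delta> k"
    if "k \<in> I" for n k
  proof -
    have "matrix_prod_on I (B_matrix z) (diagonal_matrix \<delta>) n k
        = (\<Sum>\<^sub>\<infinity>j\<in>{k}. B_matrix z n j * diagonal_matrix \<delta> j k)"
      unfolding matrix_prod_on_def
      by (rule infsum_cong_neutral) (use that in \<open>auto simp: diagonal_matrix_def\<close>)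
    then show ?thesis by (simp add: diagonal_matrix_def)
  qed
  have BDC: "matrix_prod_on I (matrix_prod_on I (B_matrix z) (diagonal_matrix \<delta>)) (C_matrix y) n x
      = (\<Sum>k = 0..min n x. \<delta> k * B_matrix z n k * C_matrix y k x)" if "n \<in> I" for n x
  proof -
    \<comment> \<open>Beyond \<open>min n x\<close> a triangular factor vanishes, and
      \<open>{0..min n x}\<close> lies inside \<open>I\<close> because \<open>I\<close> is downward
      closed, so the infinite sum is finite.\<close>
    have "matrix_prod_on I (matrix_prod_on I (B_matrix z) (diagonal_matrix \<delta>)) (C_matrix y) n x
        = (\<Sum>\<^sub>\<infinity>k\<in>{0..min n x}. \<delta> k * B_matrix z n k * C_matrix y k x)"
      unfolding matrix_prod_on_def[of I "matrix_prod_on I (B_matrix z) (diagonal_matrix \<delta>)"]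
    proof (rule infsum_cong_neutral)
      fix k assume "k \<in> I - {0..min n x}"
      then have "n < k \<or> x < k" by auto
      with \<open>k \<in> I - {0..min n x}\<close>
      show "matrix_prod_on I (B_matrix z) (diagonal_matrix \<delta>) n k * C_matrix y k x = 0"
        by (auto simp: BD B_zero C_zero)
    qed (use down_closed[OF that] in \<open>auto simp: BD\<close>)
    then show ?thesis by simp
  qed
  show ?thesis
  proof (intro conjI exI[of _ \<delta>])
    show "lower_triangular_on I (B_matrix z)" "upper_triangular_on I (C_matrix y)"
      by (auto simp: lower_triangular_on_def upper_triangular_on_def B_zero C_zero)
  qed (auto simp: \<delta>_nonzero BDC P P_matrix_def B_matrix_def C_matrix_def)
qed

end
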